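(* Let $n$ be an even positive integer and let $F\colon\mathbb{F}_{2^{n/2}}\times\mathbb{F}_{2^{n/2}}\to\mathbb{F}_{2^{n/2}}$ be an o-polynomial bent function defined by $$F(x,y)=x\,\Psi\!\left(yx^{2^{n/2}-2}\right),$$ where $\Psi\colon\mathbb{F}_{2^{n/2}}\to\mathbb{F}_{2^{n/2}}$ is an o-polynomial. Then $|F^{-1}(0)|=2^{n/2+1}-1$ and $|F^{-1}(\beta)|=2^{n/2}-1$ for each $\beta\neq0$; hence $F$ is almost balanced of type $(+)$.
   Context: A permutation polynomial $\Psi$ over $\mathbb{F}_{2^k}$ is called an o-polynomial if for every $a\in\mathbb{F}_{2^k}^*$ the function sending $z\neq0$ to $\frac{\Psi(z+a)+\Psi(a)}{z}$ and $0$ to $0$ is a permutation of $\mathbb{F}_{2^k}$. The expression $x^{2^{n/2}-2}$ stands for $x^{-1}$ with $0^{-1}=0$. A function $F\colon\mathbb{F}_2^n\to\mathbb{F}_2^m$ is bent (perfect nonlinear) if $|\{x: F(x+a)-F(x)=b\}|=2^{n-m}$ for all nonzero $a$ and all $b$; it is understood (hypothesis) that the $F$ in the claim is bent, with $\mathbb{F}_{2^{n/2}}\times\mathbb{F}_{2^{n/2}}$ identified with $\mathbb{F}_2^n$ and $\mathbb{F}_{2^{n/2}}$ with $\mathbb{F}_2^{n/2}$. A bent function $F\colon\mathbb{F}_2^n\to\mathbb{F}_2^m$ is almost balanced of type $(+)$ if there is $\alpha$ with $|F^{-1}(\alpha)|=2^{n-m}+2^{n/2}-2^{n/2-m}$ and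 $|F^{-1}(\beta)|=2^{n-m}-2^{n/2-m}$ for all $\beta\ne\alpha$; here $m=n/2$. *)

theory Defs
  imports
    Complex_Main
    "HOL-Library.Cardinality"
    "HOL-Library.Product_Plus"
    "HOL-Computational_Algebra.Polynomial"
begin

text \<open>
  Bentness and the sizes of preimage sets only involve the additive structure, so the vector
  space of dimension \<open>n\<close> over the two-element field is represented by an arbitrary finite abelian
  group of exponent (at most) 2 and order \<open>2 ^ n\<close>; every such group is isomorphic to it.
\<close>

definition F2_space :: "'v::{ab_group_add,finite} itself \<Rightarrow> nat \<Rightarrow> bool" where
  "F2_space _ n \<longleftrightarrow> (\<forall>x::'v. x + x = 0) \<and> CARD('v) = 2 ^ n"

definition bent ::
  "nat \<Rightarrow> nat \<Rightarrow> ('v::{ab_group_add,finite} \<Rightarrow> 'w::{ab_group_add,finite}) \<Rightarrow> bool" where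
  "bent n m F \<longleftrightarrow> F2_space TYPE('v) n \<and> F2_space TYPE('w) m \<and>
     (\<forall>a b. a \<noteq> 0 \<longrightarrow> real (card {x. F (x + a) - F x = b}) = 2 powr (real n - real m))"

definition almost_balanced_plus ::
  "nat \<Rightarrow> nat \<Rightarrow> ('v::{ab_group_add,finite} \<Rightarrow> 'w::{ab_group_add,finite}) \<Rightarrow> bool" where
  "almost_balanced_plus n m F \<longleftrightarrow> bent n m F \<and>
     (\<exists>\<alpha>. real (card (F -` {\<alpha>})) =
            2 powr (real n - real m) + 2 powr (real n / 2) - 2 powr (real n / 2 - real m) \<and>
          (\<forall>\<beta>. \<beta> \<noteq> \<alpha> \<longrightarrow>
            real (card (F -` {\<beta>})) = 2 powr (real n - real m) - 2 powr (real n / 2 - real m)))"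

definition permutation_polynomial :: "'a::{field,finite} poly \<Rightarrow> bool" where
  "permutation_polynomial P \<longleftrightarrow> bij (poly P)"

text \<open>The field is meant to have characteristic 2, which is why \<open>+\<close> replaces \<open>-\<close> in the slope.\<close>

definition o_polynomial :: "'a::{field,finite} poly \<Rightarrow> bool" where
  "o_polynomial P \<longleftrightarrow> permutation_polynomial P \<and>
     (\<forall>a. a \<noteq> 0 \<longrightarrow> bij (\<lambda>z. if z = 0 then 0 else (poly P (z + a) + poly P a) / z))"

end

theory Submission imports Defs begin

text \<open>
  On the line \<open>x = 0\<close> the function vanishes, and for fixed \<open>x \<noteq> 0\<close> the map
  \<open>y \<mapsto> x \<Psi>(y c)\<close> with \<open>c = x ^ k \<noteq> 0\<close> is a permutation of the field. So every fibre
  contains exactly one point on each of the \<open>q - 1\<close> lines \<open>x = const \<noteq> 0\<close>, and the fibre of \<open>0\<close>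
  contains in addition the \<open>q\<close> points with \<open>x = 0\<close>.
\<close>

text \<open>The exponent \<open>k\<close> is arbitrary because \<open>x ^ k\<close> is nonzero for
  every nonzero \<open>x\<close>, and that makes scaling by it invertible.\<close>

lemma card_fibre_scaled_perm:
  fixes p :: "'a::{field,finite} \<Rightarrow> 'a" and F :: "'a \<times> 'a \<Rightarrow> 'a"
  assumes p: "bij p" and F: "\<And>x y. F (x, y) = x * p (y * x ^ k)"
  shows "card (F -` {b}) = (if b = 0 then CARD('a) else 0) + (CARD('a) - 1)"
proof -
  let ?Z = "if b = 0 then {0} \<times> (UNIV :: 'a set) else {} :: ('a \<times> 'a) set"
  let ?g = "\<lambda>x. (x, inv p (b / x) / x ^ k)"
  have "F (x, y) = b \<longleftrightarrow> y = inv p (b / x) / x ^ k" if "x \<noteq> 0" for x y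
  proof -
    have "F (x, y) = b \<longleftrightarrow> p (y * x ^ k) = b / x"
      using that by (auto simp: F field_simps)
    also have "\<dots> \<longleftrightarrow> y * x ^ k = inv p (b / x)"
      using p by (metis bij_inv_eq_iff)
    finally show ?thesis
      using that by (simp add: field_simps)
  qed
  \<comment> \<open>The outer factor \<open>x\<close> forces this for every \<open>k\<close>, even
    for \<open>k = 0\<close>, where \<open>0 ^ k = 1\<close>; that case occurs for the field of
    order 2.\<close>
  moreover have "F (0, y) = 0" for y
    by (simp add: F)
  ultimately have "(x, y) \<in> F -` {b} \<longleftrightarrow> (x, y) \<in> ?Z \<union> ?g ` (- {0})" for x y
    by (cases "x = 0") auto
  then have "F -` {b} = ?Z \<union> ?g ` (- {0})"
    by (intro set_eqI) (simp only: split_paired_all)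
  moreover have "card (?Z \<union> ?g ` (- {0})) = card ?Z + card (?g ` (- {0}))"
    by (rule card_Un_disjoint) auto
  \<comment> \<open>\<open>?g\<close> is injective because its first component is \<open>x\<close>
    itself.\<close>
  moreover have "card (?g ` (- {0})) = CARD('a) - 1"
    by (simp add: card_image inj_on_def Compl_eq_Diff_UNIV)
  ultimately show ?thesis
    by (simp add: card_cartesian_product)
qed

theorem proposition3p4:
  fixes n :: nat
    and \<Psi> :: "'a::{field,finite} poly"
    and F :: "'a \<times> 'a \<Rightarrow> 'a"
  assumes "even n" and "n > 0"
    and "CARD('a) = 2 ^ (n div 2)"
    and "o_polynomial \<Psi>"
    and "\<And>x y. F (x, y) = x * poly \<Psi> (y * x ^ (2 ^ (n div 2) - 2))"
    and "bent n (n div 2) F"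
  shows "card (F -` {0}) = 2 ^ (n div 2 + 1) - 1 \<and>
         (\<forall>\<beta>. \<beta> \<noteq> 0 \<longrightarrow> card (F -` {\<beta>}) = 2 ^ (n div 2) - 1) \<and>
         almost_balanced_plus n (n div 2) F"
proof -
  define m where "m = n div 2"
  have n: "n = 2 * m"
    using assms(1) by (simp add: m_def)
  have "bij (poly \<Psi>)"
    using assms(4) by (simp add: o_polynomial_def permutation_polynomial_def)
  note card_fibre = card_fibre_scaled_perm[OF this assms(5)]
  have zero: "card (F -` {0}) = 2 ^ (m + 1) - 1"
    by (simp add: card_fibre assms(3) m_def)
  have nonzero: "card (F -` {\<beta>}) = 2 ^ m - 1" if "\<beta> \<noteq> 0" for \<beta>
    using that by (simp add: card_fibre assms(3) m_def)
  have "almost_balanced_plus n m F"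
    unfolding almost_balanced_plus_def
  \<comment> \<open>The exceptional value is 0, whose fibre contains the line \<open>x = 0\<close>.
    As \<open>n = 2 * m\<close>, the powers in the definition are \<open>2 ^ m\<close>,
    \<open>2 ^ m\<close> and 1.\<close>
  proof (intro conjI exI[of _ 0] allI impI)
    show "bent n m F"
      using assms(6) by (simp add: m_def)
    show "real (card (F -` {0})) =
        2 powr (real n - real m) + 2 powr (real n / 2) - 2 powr (real n / 2 - real m)"
      by (simp add: zero n powr_realpow of_nat_diff)
    show "real (card (F -` {\<beta>})) = 2 powr (real n - real m) - 2 powr (real n / 2 - real m)"
      if "\<beta> \<noteq> 0" for \<beta>
      using that by (simp add: nonzero n powr_realpow of_nat_diff)
  qed
  with zero nonzero show ?thesis
    by (simp add: m_def)
qed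

end
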